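(* For any $\epsilon>0$, the adaptive weight order algorithm, which at every time $t$ processes every $j\in F_t$ with rate $(H_{|F_t|}\cdot i_j)^{-1}$, where $i_j$ is the position of $j$ in $\hat\preceq_t$, has a competitive ratio of at most $4H_\omega\cdot\max\{1+\epsilon,\mathcal L(\epsilon)\}$ for minimizing the total weighted completion time on a single machine with online out-forest precedence constraints.
   Context: Problem (non-clairvoyant single-machine scheduling with online precedence constraints): jobs $J$ with processing requirements $p_j\ge0$ and weights $w_j\ge0$; precedence DAG $G=(J,E)$ which is an out-forest (every job has at most one incoming edge). A job may be processed only after all its predecessors are completed and is revealed (without its processing requirement) only then; $G$ is unknown. Time is discrete; rates $R_j^t\ge0$, $\sum_jR_j^t\le1$; $C_j$ is the first $t$ with $\sum_{t'\le t}R_j^{t'}\ge p_j$. Front jobs: $F_t=\{j: C_j>t,\ C_{j'}<t\ \forall(j',j)\in E\}$. Objective: minimize $\sum_jw_jC_j$ against the offline optimum. The width $\omega$ is the maximum size of an antichain of $G$; $H_k=\sum_{i=1}^k 1/i$. $S(v)$ is $v$ with all its successors, $w(S(v))=\sum_{u\in S(v)}w_u$. Adaptive weight order predictions: at each time $t$ the algorithm receives a total order $\hat\preceq_t$ on $F_t$, a prediction of the order of $F_t$ by non-increasing $w(S(\cdot))$. For $\epsilon>0$, $\mathcal L(\epsilon)=\max_{t,\,j\in F_t}\left|\left\{i\in F_t:\ \frac{w(S(j))}{1+\epsilon}\ge w(S(i))\text{ and } i\,\hat\preceq_t\, j\right\}\right|$.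
   Formalization: F_t is taken with C_j ≥ t instead of C_j > t (the literal definition is circular: no job could receive its last slot), time slots start at t = 1, and a job with p_j = 0 counts as completed only after its predecessors are completed. *)

theory Defs
  imports "HOL-Analysis.Harmonic_Numbers" "HOL-Library.Extended_Nat"
begin

text \<open>An instance consists of a job set \<open>J\<close>, precedence edges \<open>E\<close> (\<open>(i, j) \<in> E\<close>: \<open>i\<close> precedes
  \<open>j\<close>), processing requirements \<open>p\<close> and weights \<open>w\<close>.\<close>

definition out_forest_instance ::
  "'a set \<Rightarrow> ('a \<times> 'a) set \<Rightarrow> ('a \<Rightarrow> real) \<Rightarrow> ('a \<Rightarrow> real) \<Rightarrow> bool" where
  "out_forest_instance J E p w \<longleftrightarrow>
     finite J \<and> E \<subseteq> J \<times> J \<and> acyclic E \<and>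
     (\<forall>i i' j. (i, j) \<in> E \<longrightarrow> (i', j) \<in> E \<longrightarrow> i = i') \<and>
     (\<forall>j\<in>J. 0 \<le> p j \<and> 0 \<le> w j)"

definition antichain :: "('a \<times> 'a) set \<Rightarrow> 'a set \<Rightarrow> bool" where
  "antichain E A \<longleftrightarrow> (\<forall>a\<in>A. \<forall>b\<in>A. a \<noteq> b \<longrightarrow> (a, b) \<notin> E\<^sup>+)"

definition width :: "'a set \<Rightarrow> ('a \<times> 'a) set \<Rightarrow> nat" where
  "width J E = Max {card A | A. A \<subseteq> J \<and> antichain E A}"

definition succs :: "('a \<times> 'a) set \<Rightarrow> 'a \<Rightarrow> 'a set" where
  "succs E v = {u. (v, u) \<in> E\<^sup>*}"

definition wS :: "('a \<times> 'a) set \<Rightarrow> ('a \<Rightarrow> real) \<Rightarrow> 'a \<Rightarrow> real" where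
  "wS E w v = (\<Sum>u\<in>succs E v. w u)"

text \<open>A schedule \<open>R\<close> assigns to slot \<open>t = 1, 2, \<dots>\<close> and job \<open>j\<close> the rate \<open>R t j\<close>; its values at
  slot \<open>0\<close> are never used. \<open>completed J E p R t\<close> is the set of jobs completed by the end of slot
  \<open>t\<close>. The condition on predecessors only matters for jobs with \<open>p j = 0\<close>, which would otherwise
  count as completed before they are even revealed; see \<open>completion_eq\<close>.\<close>

primrec completed ::
  "'a set \<Rightarrow> ('a \<times> 'a) set \<Rightarrow> ('a \<Rightarrow> real) \<Rightarrow> (nat \<Rightarrow> 'a \<Rightarrow> real) \<Rightarrow> nat \<Rightarrow> 'a set" where
  "completed J E p R 0 = {}"
| "completed J E p R (Suc t) = completed J E p R t \<union>
     {j\<in>J. (\<forall>i. (i, j) \<in> E \<longrightarrow> i \<in> completed J E p R t) \<and> p j \<le> (\<Sum>s=1..Suc t. R s j)}"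

definition completion ::
  "'a set \<Rightarrow> ('a \<times> 'a) set \<Rightarrow> ('a \<Rightarrow> real) \<Rightarrow> (nat \<Rightarrow> 'a \<Rightarrow> real) \<Rightarrow> 'a \<Rightarrow> enat" where
  "completion J E p R j = (INF t\<in>{t. j \<in> completed J E p R t}. enat t)"

text \<open>A job completed in slot \<open>t\<close> is still processed in slot \<open>t\<close>, so it belongs to the front of slot
  \<open>t\<close>: the front consists of the jobs that are available and unfinished when slot \<open>t\<close> begins.\<close>

definition front ::
  "'a set \<Rightarrow> ('a \<times> 'a) set \<Rightarrow> ('a \<Rightarrow> real) \<Rightarrow> (nat \<Rightarrow> 'a \<Rightarrow> real) \<Rightarrow> nat \<Rightarrow> 'a set" where
  "front J E p R t = {j\<in>J. enat t \<le> completion J E p R j \<and>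
     (\<forall>i. (i, j) \<in> E \<longrightarrow> completion J E p R i < enat t)}"

definition feasible ::
  "'a set \<Rightarrow> ('a \<times> 'a) set \<Rightarrow> ('a \<Rightarrow> real) \<Rightarrow> (nat \<Rightarrow> 'a \<Rightarrow> real) \<Rightarrow> bool" where
  "feasible J E p R \<longleftrightarrow>
     (\<forall>t\<ge>1. \<forall>j\<in>J. 0 \<le> R t j) \<and>
     (\<forall>t\<ge>1. (\<Sum>j\<in>J. R t j) \<le> 1) \<and>
     (\<forall>t\<ge>1. \<forall>j\<in>J. R t j > 0 \<longrightarrow> (\<forall>i. (i, j) \<in> E \<longrightarrow> completion J E p R i < enat t)) \<and>
     (\<forall>j\<in>J. completion J E p R j < \<infinity>)"

definition cost ::
  "'a set \<Rightarrow> ('a \<times> 'a) set \<Rightarrow> ('a \<Rightarrow> real) \<Rightarrow> ('a \<Rightarrow> real) \<Rightarrow> (nat \<Rightarrow> 'a \<Rightarrow> real) \<Rightarrow> real" where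
  "cost J E p w R = (\<Sum>j\<in>J. w j * real (the_enat (completion J E p R j)))"

definition opt :: "'a set \<Rightarrow> ('a \<times> 'a) set \<Rightarrow> ('a \<Rightarrow> real) \<Rightarrow> ('a \<Rightarrow> real) \<Rightarrow> real" where
  "opt J E p w = (INF R\<in>{R. feasible J E p R}. cost J E p w R)"

definition position :: "'a set \<Rightarrow> 'a rel \<Rightarrow> 'a \<Rightarrow> nat" where
  "position F r j = card {i\<in>F. (i, j) \<in> r}"

text \<open>The rates depend only on the front and the predicted order of the front (\<open>(i, j) \<in> r\<close>: \<open>i\<close>
  comes no later than \<open>j\<close>).\<close>

definition awo_rate :: "'a set \<Rightarrow> 'a rel \<Rightarrow> 'a \<Rightarrow> real" where
  "awo_rate F r j = (if j \<in> F then inverse (harm (card F) * real (position F r j)) else 0)"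

text \<open>\<open>awo_upto J E p ord t\<close> is the algorithm's schedule in slots \<open>1, \<dots>, t\<close>, and \<open>0\<close> later, where
  \<open>ord t\<close> is the prediction received in slot \<open>t\<close>. The front of slot \<open>t + 1\<close> is determined by the
  slots up to \<open>t\<close>; see \<open>awo_eq\<close> for the resulting description of the full schedule.\<close>

primrec awo_upto ::
  "'a set \<Rightarrow> ('a \<times> 'a) set \<Rightarrow> ('a \<Rightarrow> real) \<Rightarrow> (nat \<Rightarrow> 'a rel) \<Rightarrow> nat \<Rightarrow> nat \<Rightarrow> 'a \<Rightarrow> real" where
  "awo_upto J E p ord 0 = (\<lambda>_ _. 0)"
| "awo_upto J E p ord (Suc t) = (awo_upto J E p ord t)
     (Suc t := awo_rate (front J E p (awo_upto J E p ord t) (Suc t)) (ord (Suc t)))"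

definition awo ::
  "'a set \<Rightarrow> ('a \<times> 'a) set \<Rightarrow> ('a \<Rightarrow> real) \<Rightarrow> (nat \<Rightarrow> 'a rel) \<Rightarrow> nat \<Rightarrow> 'a \<Rightarrow> real" where
  "awo J E p ord t = awo_upto J E p ord t t"

definition order_error ::
  "'a set \<Rightarrow> ('a \<times> 'a) set \<Rightarrow> ('a \<Rightarrow> real) \<Rightarrow> ('a \<Rightarrow> real) \<Rightarrow> (nat \<Rightarrow> 'a \<Rightarrow> real) \<Rightarrow>
   (nat \<Rightarrow> 'a rel) \<Rightarrow> real \<Rightarrow> nat" where
  "order_error J E p w R ord \<epsilon> =
     Max {card {i \<in> front J E p R t. wS E w j / (1 + \<epsilon>) \<ge> wS E w i \<and> (i, j) \<in> ord t} | t j.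
            1 \<le> t \<and> j \<in> front J E p R t}"

lemma completed_mono: "s \<le> t \<Longrightarrow> completed J E p R s \<subseteq> completed J E p R t"
  by (rule lift_Suc_mono_le[of "completed J E p R"]) auto

lemma completed_cong:
  "(\<And>s j. 1 \<le> s \<Longrightarrow> s \<le> t \<Longrightarrow> R s j = R' s j) \<Longrightarrow> completed J E p R t = completed J E p R' t"
proof (induction t)
  case (Suc t)
  have "completed J E p R t = completed J E p R' t" using Suc by simp
  moreover have "(\<Sum>s=1..Suc t. R s j) = (\<Sum>s=1..Suc t. R' s j)" for j
    using Suc.prems by (intro sum.cong) auto
  ultimately show ?case by simp
qed simp

lemma completion_less_Suc_iff:
  "completion J E p R j < enat (Suc t) \<longleftrightarrow> j \<in> completed J E p R t"
proof
  assume "completion J E p R j < enat (Suc t)"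
  then obtain s where "j \<in> completed J E p R s" "s < Suc t"
    by (auto simp: completion_def INF_less_iff)
  then show "j \<in> completed J E p R t" using completed_mono[of s t J E p R] by auto
next
  assume "j \<in> completed J E p R t"
  then show "completion J E p R j < enat (Suc t)"
    unfolding completion_def INF_less_iff by (intro bexI[of _ t]) auto
qed

lemma front_Suc:
  "front J E p R (Suc t) =
     {j\<in>J. j \<notin> completed J E p R t \<and> (\<forall>i. (i, j) \<in> E \<longrightarrow> i \<in> completed J E p R t)}"
  by (auto simp: front_def completion_less_Suc_iff simp flip: not_less)

lemma awo_upto_eq: "1 \<le> s \<Longrightarrow> s \<le> t \<Longrightarrow> awo_upto J E p ord t s = awo J E p ord s"
proof (induction t)
  case (Suc t)
  then show ?case by (cases "s = Suc t") (auto simp: awo_def)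
qed simp

lemma awo_eq:
  assumes "1 \<le> t"
  shows "awo J E p ord t j = awo_rate (front J E p (awo J E p ord) t) (ord t) j"
proof -
  obtain u where t: "t = Suc u" using assms by (cases t) auto
  have "completed J E p (awo_upto J E p ord u) u = completed J E p (awo J E p ord) u"
    by (rule completed_cong) (simp add: awo_upto_eq)
  then show ?thesis by (simp add: t awo_def[of J E p ord "Suc u"] front_Suc)
qed

lemma completion_eq:
  assumes prec: "\<And>t i. 1 \<le> t \<Longrightarrow> R t j > 0 \<Longrightarrow> (i, j) \<in> E \<Longrightarrow> completion J E p R i < enat t"
    and j: "j \<in> J" and pos: "0 < p j"
  shows "completion J E p R j = (INF t\<in>{t. p j \<le> (\<Sum>s=1..t. R s j)}. enat t)"
proof (rule antisym)
  have "\<exists>s\<le>t. p j \<le> (\<Sum>s=1..s. R s j)" if "j \<in> completed J E p R t" for t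
    using that by (induction t) (auto intro: le_SucI)
  then show "(INF t\<in>{t. p j \<le> (\<Sum>s=1..t. R s j)}. enat t) \<le> completion J E p R j"
    unfolding completion_def by (intro INF_mono) auto
next
  define m where "m = (LEAST t. p j \<le> (\<Sum>s=1..t. R s j))"
  have "j \<in> completed J E p R m" and "m \<le> t" if t: "p j \<le> (\<Sum>s=1..t. R s j)" for t
  proof -
    show "m \<le> t" unfolding m_def using t by (rule Least_le)
    have m: "p j \<le> (\<Sum>s=1..m. R s j)" unfolding m_def using t by (rule LeastI)
    then obtain u where u: "m = Suc u" using pos by (cases m) auto
    have "\<not> p j \<le> (\<Sum>s=1..u. R s j)" using not_less_Least[of u "\<lambda>t. p j \<le> (\<Sum>s=1..t. R s j)"] u
      unfolding m_def[symmetric] by simp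
    with m have "R (Suc u) j > 0" by (simp add: u)
    then have "i \<in> completed J E p R u" if "(i, j) \<in> E" for i
      using prec[of "Suc u" i] that by (simp add: completion_less_Suc_iff)
    with m j show "j \<in> completed J E p R m" by (simp add: u)
  qed
  then show "completion J E p R j \<le> (INF t\<in>{t. p j \<le> (\<Sum>s=1..t. R s j)}. enat t)"
    unfolding completion_def by (intro INF_mono) auto
qed

end

theory Submission
  imports Defs
begin

text \<open>Let \<open>K = max (1 + \<epsilon>) L\<close> and \<open>M = H\<^sub>\<omega> * K\<close>, and let \<open>W\<close> be the weight of the unfinished jobs,
  which is the sum of \<open>w(S(j))\<close> over the front since the precedence graph is an out-forest. Splitting
  the jobs ranked before \<open>j\<close> into those of comparable weight and those counted by \<open>L\<close> shows that
  \<open>j\<close> is processed at rate at least \<open>w(S(j)) / (M * (W + w(S(j))))\<close>.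

  The total cost is the sum of \<open>W\<close> over all slots. It is charged to two potentials, each of which is
  initially at most the cost of an arbitrary feasible schedule \<open>R\<close>. The work potential sums, over all
  jobs \<open>u\<close>, \<open>w u\<close> times the work that \<open>R\<close> performs up to the completion of \<open>u\<close>, not counting the
  first units of each job which the algorithm has already processed. The depth potential sums \<open>w u\<close>
  times the number of unfinished jobs on the path to \<open>u\<close>; it accounts for the capacity
  that the algorithm wastes on jobs which finish in the middle of a slot. Let \<open>b\<close> be the part of \<open>W\<close>
  below front jobs that do not finish in the current slot. The depth potential drops by at least
  \<open>W - b\<close>, and the work potential by at least \<open>2 / 5 * b\<^sup>2 / (M * W)\<close>: if two such jobs \<open>j\<close>, \<open>l\<close> are
  compared by the slots in which \<open>R\<close> passes the algorithm's progress on them, then processing the earlier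
  one saves work for all of the successors of the later one. Hence \<open>5 / 2 * M\<close> times the first drop
  plus \<open>3 / 2 * M\<close> times the second is at least \<open>W\<close>.\<close>

section \<open>Generic inequalities\<close>

text \<open>Of two indices at least one comes first under \<tau>, and an index ties with itself in
  both directions. Symmetrising the right-hand side thus covers every pair once and the diagonal
  twice.\<close>

lemma sum_square_le_ordered_pairs:
  fixes a :: "'a \<Rightarrow> real" and \<tau> :: "'a \<Rightarrow> 'b::linorder"
  assumes "finite B" and "\<And>j. j \<in> B \<Longrightarrow> 0 \<le> a j"
  shows "(\<Sum>j\<in>B. a j)\<^sup>2 + (\<Sum>j\<in>B. (a j)\<^sup>2)
    \<le> 2 * (\<Sum>j\<in>B. \<Sum>l\<in>B. of_bool (\<tau> j \<le> \<tau> l) * (a j * a l))"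
proof -
  have "(\<Sum>j\<in>B. a j)\<^sup>2 + (\<Sum>j\<in>B. (a j)\<^sup>2)
      = (\<Sum>j\<in>B. \<Sum>l\<in>B. a j * a l) + (\<Sum>j\<in>B. \<Sum>l\<in>B. of_bool (j = l) * (a j * a l))"
    using assms(1)
    by (simp add: power2_eq_square sum_product of_bool_def if_distrib[of "\<lambda>x. x * _"] sum.delta
        cong: if_cong)
  also have "\<dots> = (\<Sum>j\<in>B. \<Sum>l\<in>B. (1 + of_bool (j = l)) * (a j * a l))"
    by (simp add: sum.distrib distrib_right)
  also have "\<dots> \<le> (\<Sum>j\<in>B. \<Sum>l\<in>B. (of_bool (\<tau> j \<le> \<tau> l) + of_bool (\<tau> l \<le> \<tau> j)) * (a j * a l))"
    using assms(2) by (intro sum_mono mult_right_mono) (auto simp: of_bool_def)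
  also have "\<dots> = (\<Sum>j\<in>B. \<Sum>l\<in>B. of_bool (\<tau> j \<le> \<tau> l) * (a j * a l))
      + (\<Sum>j\<in>B. \<Sum>l\<in>B. of_bool (\<tau> l \<le> \<tau> j) * (a j * a l))"
    by (simp add: sum.distrib distrib_right)
  also have "(\<Sum>j\<in>B. \<Sum>l\<in>B. of_bool (\<tau> l \<le> \<tau> j) * (a j * a l))
      = (\<Sum>j\<in>B. \<Sum>l\<in>B. of_bool (\<tau> j \<le> \<tau> l) * (a j * a l))"
    by (subst sum.swap) (simp add: mult.commute)
  finally show ?thesis by simp
qed

text \<open>Arithmetic of one slot: \<open>W\<close> is the open weight, \<open>b\<close> its part
  below front jobs that stay unfinished, \<open>m\<close> the largest weight among those,
  \<open>X\<close> is \<open>M\<close> times the work drop and \<open>Y\<close> the depth drop.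
  First \<open>m\<close> is eliminated, then \<open>Y\<close> pays for \<open>W - b\<close>.\<close>

lemma slot_inequality:
  fixes W b m M X Y :: real
  assumes "0 \<le> m" "m \<le> b" "b \<le> W" "1 \<le> M" "0 \<le> X"
    and X: "b\<^sup>2 + m\<^sup>2 \<le> 2 * (X * (W + m))" and Y: "W - b \<le> Y"
    and M: "3 / 2 \<le> M \<or> b = 0 \<or> b = W"
  shows "W \<le> 5 / 2 * X + 3 / 2 * (M * Y)"
proof (cases "W = 0")
  case True
  then have "0 \<le> M * Y" using assms by (intro mult_nonneg_nonneg) auto
  then show ?thesis using True assms by simp
next
  case False
  then have W: "0 < W" using assms by simp
  have "b\<^sup>2 * (W + m) \<le> 5 / 4 * (W * (b\<^sup>2 + m\<^sup>2))"
  proof -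
    have "b\<^sup>2 \<le> W\<^sup>2" using assms by (intro power_mono) auto
    \<comment> \<open>AM-GM: the mixed term \<open>m * b\<^sup>2\<close> costs
      \<open>W * m\<^sup>2\<close> and a quarter of \<open>b\<^sup>2 * W\<close>, whence the factor
      5/4.\<close>
    have "0 \<le> (W * m - b\<^sup>2 / 2)\<^sup>2" by simp
    then have "W * m * b\<^sup>2 \<le> W\<^sup>2 * m\<^sup>2 + b\<^sup>2 * b\<^sup>2 / 4"
      by (simp add: power2_eq_square algebra_simps)
    also have "\<dots> \<le> W\<^sup>2 * m\<^sup>2 + b\<^sup>2 * W\<^sup>2 / 4"
      using mult_left_mono[OF \<open>b\<^sup>2 \<le> W\<^sup>2\<close>, of "b\<^sup>2"] by simp
    finally have "W * (m * b\<^sup>2) \<le> W * (W * m\<^sup>2 + b\<^sup>2 * W / 4)"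
      by (simp add: power2_eq_square algebra_simps)
    then have "m * b\<^sup>2 \<le> W * m\<^sup>2 + b\<^sup>2 * W / 4" using W by simp
    moreover have "0 \<le> W * m\<^sup>2" using W by simp
    ultimately show ?thesis by (simp add: algebra_simps)
  qed
  also have "\<dots> \<le> 5 / 4 * (W * (2 * (X * (W + m))))"
    using X W by (intro mult_left_mono) auto
  finally have "b\<^sup>2 * (W + m) \<le> (5 / 2 * X * W) * (W + m)" by (simp add: algebra_simps)
  then have b: "b\<^sup>2 \<le> 5 / 2 * X * W" using W assms(1) by (simp add: mult_le_cancel_right)
  \<comment> \<open>This is \<open>3 / 2 * M * (W - b) * W - (W\<^sup>2 - b\<^sup>2)\<close> with
    \<open>W - b\<close> factored out. Away from the extremes of \<open>b\<close>, the bound on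
    \<open>M\<close> gives \<open>3 / 2 * M \<ge> 2\<close>, which covers
    \<open>W + b \<le> 2 * W\<close>.\<close>
  have "0 \<le> (W - b) * (3 / 2 * M * W - W - b)"
  proof (cases "b = W")
    case False
    have "0 \<le> 3 / 2 * M * W - W - b"
    proof (cases "b = 0")
      case True
      have "1 * W \<le> (3 / 2 * M) * W" using W assms by (intro mult_right_mono) auto
      then show ?thesis using True by simp
    next
      case b: False
      have "2 * W \<le> (3 / 2 * M) * W" using W False b M by (intro mult_right_mono) auto
      then show ?thesis using assms by simp
    qed
    then show ?thesis using assms by simp
  qed simp
  then have "W * W \<le> b\<^sup>2 + 3 / 2 * (M * (W - b)) * W"
    by (simp add: algebra_simps power2_eq_square)
  also have "\<dots> \<le> 5 / 2 * X * W + 3 / 2 * (M * Y) * W"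
    using b W Y assms(4) by (intro add_mono mult_right_mono mult_left_mono) auto
  finally have "W * W \<le> (5 / 2 * X + 3 / 2 * (M * Y)) * W" by (simp add: algebra_simps)
  then show ?thesis using W by simp
qed

text \<open>Of two distinct elements the later one has the strictly larger initial segment, so
  positions are injective, with only \<open>card F\<close> possible values.\<close>

lemma bij_betw_position:
  assumes "finite F" and "linear_order_on F r"
  shows "bij_betw (position F r) F {1..card F}"
proof -
  have refl: "(j, j) \<in> r" if "j \<in> F" for j
    using assms(2) that by (auto simp: order_on_defs refl_on_def)
  have strict: "position F r j < position F r l" if "j \<in> F" "l \<in> F" "j \<noteq> l" "(j, l) \<in> r" for j l
  proof -
    have "trans r" "antisym r" using assms(2) by (auto simp: order_on_defs)
    then have "{i\<in>F. (i, j) \<in> r} \<subset> {i\<in>F. (i, l) \<in> r}"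
      using that refl[of l] by (auto dest: transD antisymD)
    then show ?thesis unfolding position_def using assms(1) by (intro psubset_card_mono) auto
  qed
  have inj: "inj_on (position F r) F"
  proof (rule inj_onI, rule ccontr)
    fix j l assume *: "j \<in> F" "l \<in> F" "position F r j = position F r l" "j \<noteq> l"
    then have "(j, l) \<in> r \<or> (l, j) \<in> r" using assms(2) by (auto simp: order_on_defs total_on_def)
    then show False using strict[of j l] strict[of l j] * by auto
  qed
  moreover have "position F r ` F \<subseteq> {1..card F}"
  proof clarify
    fix j assume "j \<in> F"
    then have "0 < position F r j" using refl[of j] assms(1) by (auto simp: position_def card_gt_0_iff)
    moreover have "position F r j \<le> card F"
      unfolding position_def using assms(1) by (intro card_mono) auto
    ultimately show "position F r j \<in> {1..card F}" by simp
  qed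
  ultimately show ?thesis
    unfolding bij_betw_def by (simp add: card_image card_subset_eq)
qed

text \<open>The reciprocal positions sum to the harmonic number by which the rates are
  normalised.\<close>

lemma sum_awo_rate:
  assumes "finite F" and "F \<noteq> {}" and "linear_order_on F r"
  shows "(\<Sum>j\<in>F. awo_rate F r j) = 1"
proof -
  have "(\<Sum>j\<in>F. awo_rate F r j) = inverse (harm (card F)) * (\<Sum>j\<in>F. inverse (real (position F r j)))"
    by (simp add: awo_rate_def sum_distrib_left)
  also have "(\<Sum>j\<in>F. inverse (real (position F r j))) = harm (card F)"
    unfolding harm_def by (rule sum.reindex_bij_betw[OF bij_betw_position[OF assms(1,3)]])
  also have "inverse (harm (card F)) * harm (card F) = (1::real)"
    using assms by (intro left_inverse) (auto simp: card_gt_0_iff intro!: harm_pos less_imp_neq[symmetric])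
  finally show ?thesis .
qed

section \<open>Out-forest instances\<close>

lemma completed_le_work:
  assumes "\<And>s. 1 \<le> s \<Longrightarrow> 0 \<le> R s j" and "j \<in> completed J E p R t"
  shows "p j \<le> (\<Sum>s=1..t. R s j)"
  using assms(2)
proof (induction t)
  case (Suc t)
  show ?case
  proof (cases "j \<in> completed J E p R t")
    case True
    then show ?thesis using Suc.IH assms(1)[of "Suc t"] by simp
  qed (use Suc.prems in auto)
qed simp

locale out_forest =
  fixes J :: "'a set" and E :: "('a \<times> 'a) set" and p w :: "'a \<Rightarrow> real"
  assumes instance_ok: "out_forest_instance J E p w"
begin

lemma finite_J: "finite J" and E_sub: "E \<subseteq> J \<times> J" and acyclic_E: "acyclic E"
  and single_valued_E: "single_valued (E\<inverse>)"
  and p_nonneg: "j \<in> J \<Longrightarrow> 0 \<le> p j" and w_nonneg: "j \<in> J \<Longrightarrow> 0 \<le> w j"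
  using instance_ok by (auto simp: out_forest_instance_def single_valued_def)

lemma rtrancl_in_J: "(i, j) \<in> E\<^sup>* \<Longrightarrow> i \<in> J \<longleftrightarrow> j \<in> J"
  by (induction rule: rtrancl_induct) (use E_sub in auto)

text \<open>Walking backwards from \<open>u\<close> is deterministic in an out-forest, so one of the
  two walks extends the other.\<close>

lemma predecessors_comparable:
  assumes "(i, u) \<in> E\<^sup>*" and "(j, u) \<in> E\<^sup>*"
  shows "(i, j) \<in> E\<^sup>* \<or> (j, i) \<in> E\<^sup>*"
  using single_valued_confluent[OF single_valued_E, of u i j] assms by (auto simp: rtrancl_converse)

lemma succs_sub_J: "v \<in> J \<Longrightarrow> succs E v \<subseteq> J"
  using rtrancl_in_J by (auto simp: succs_def)

lemma finite_succs: "v \<in> J \<Longrightarrow> finite (succs E v)"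
  using succs_sub_J finite_J finite_subset by blast

lemma wS_nonneg: "v \<in> J \<Longrightarrow> 0 \<le> wS E w v"
  unfolding wS_def using succs_sub_J w_nonneg by (intro sum_nonneg) auto

lemma completed_sub_J: "completed J E p R t \<subseteq> J"
  by (induction t) auto

text \<open>Completion in a slot refers to the predecessors before that slot, so even jobs with
  \<open>p j = 0\<close> on a path take one slot each.\<close>

lemma completed_pred: "j \<in> completed J E p R (Suc t) \<Longrightarrow> (i, j) \<in> E \<Longrightarrow> i \<in> completed J E p R t"
proof (induction t arbitrary: i j)
  case (Suc t)
  show ?case
  proof (cases "j \<in> completed J E p R (Suc t)")
    case True
    then show ?thesis using Suc.IH[OF True Suc.prems(2)] by simp
  qed (use Suc.prems in auto)
qed auto

lemma completed_trancl:
  "(i, j) \<in> E\<^sup>+ \<Longrightarrow> j \<in> completed J E p R (Suc t) \<Longrightarrow> i \<in> completed J E p R t"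
proof (induction rule: trancl_induct)
  case (step y z)
  then show ?case using completed_pred[of z R t y] completed_mono[of t "Suc t" J E p R] by auto
qed (rule completed_pred)

lemma completed_rtrancl:
  assumes "(i, j) \<in> E\<^sup>*" and "j \<in> completed J E p R t"
  shows "i \<in> completed J E p R t"
proof (cases "i = j")
  case False
  then have "(i, j) \<in> E\<^sup>+" using assms(1) by (simp add: rtrancl_eq_or_trancl)
  then show ?thesis
    using completed_trancl[of i j R t] assms(2) completed_mono[of t "Suc t" J E p R] by auto
qed (use assms in simp)

section \<open>Fronts and the subtrees below them\<close>

lemma front_incomparable:
  assumes "i \<in> front J E p R (Suc t)" and "j \<in> front J E p R (Suc t)" and "i \<noteq> j"
  shows "(i, j) \<notin> E\<^sup>*"
proof
  assume "(i, j) \<in> E\<^sup>*"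
  then obtain k where "(i, k) \<in> E\<^sup>*" "(k, j) \<in> E" using assms(3) by (auto elim: rtranclE)
  then show False using assms completed_rtrancl[of i k R t] by (auto simp: front_Suc)
qed

lemma finite_front: "finite (front J E p R t)"
  using finite_J by (rule finite_subset[rotated]) (auto simp: front_def)

lemma card_front_le_width: "card (front J E p R (Suc t)) \<le> width J E"
proof -
  have "front J E p R (Suc t) \<subseteq> J" by (auto simp: front_def)
  moreover have "antichain E (front J E p R (Suc t))"
    using front_incomparable[of _ R t] by (auto simp: antichain_def dest: trancl_into_rtrancl)
  moreover have "finite {card A | A. A \<subseteq> J \<and> antichain E A}"
  proof (rule finite_subset)
    show "{card A | A. A \<subseteq> J \<and> antichain E A} \<subseteq> card ` Pow J" by blast
    show "finite (card ` Pow J)" using finite_J by simp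
  qed
  ultimately show ?thesis unfolding width_def by (intro Max_ge) blast+
qed

lemma uncompleted_eq_UN_front:
  "J - completed J E p R t = (\<Union>j\<in>front J E p R (Suc t). succs E j)" (is "?L = ?R")
proof
  show "?R \<subseteq> ?L"
    using completed_rtrancl[of _ _ R t] rtrancl_in_J by (fastforce simp: front_Suc succs_def)
  \<comment> \<open>Climbing from \<open>u\<close> to unfinished direct predecessors terminates, and
    it ends in the front.\<close>
  have "wf E"
    using acyclic_E finite_subset[OF E_sub] finite_J by (intro finite_acyclic_wf) auto
  then have "u \<in> J - completed J E p R t \<longrightarrow> u \<in> ?R" for u
  proof (induction u rule: wf_induct_rule)
    case (less u)
    show ?case
    proof (cases "\<forall>i. (i, u) \<in> E \<longrightarrow> i \<in> completed J E p R t")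
      case True
      then show ?thesis by (auto simp: front_Suc succs_def)
    next
      case False
      then obtain i where i: "(i, u) \<in> E" "i \<notin> completed J E p R t" by auto
      then have "i \<in> ?R" using less E_sub by auto
      then show ?thesis using i(1) by (auto simp: succs_def intro: rtrancl_into_rtrancl)
    qed
  qed
  then show "?L \<subseteq> ?R" by blast
qed

text \<open>A common successor would make the two front jobs comparable.\<close>

lemma succs_front_disjoint:
  assumes "i \<in> front J E p R (Suc t)" and "j \<in> front J E p R (Suc t)" and "i \<noteq> j"
  shows "succs E i \<inter> succs E j = {}"
  using predecessors_comparable[of i _ j] front_incomparable[of i R t j]
    front_incomparable[of j R t i] assms by (auto simp: succs_def)

lemma sum_UN_succs_front:
  assumes "B \<subseteq> front J E p R (Suc t)"
  shows "(\<Sum>u\<in>(\<Union>j\<in>B. succs E j). f u) = (\<Sum>j\<in>B. \<Sum>u\<in>succs E j. f u)"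
proof (rule sum.UNION_disjoint)
  show "finite B" using assms finite_front by (rule finite_subset)
  show "\<forall>j\<in>B. finite (succs E j)" using assms finite_succs by (auto simp: front_def)
  show "\<forall>i\<in>B. \<forall>j\<in>B. i \<noteq> j \<longrightarrow> succs E i \<inter> succs E j = {}"
    using assms succs_front_disjoint[of _ R t] by blast
qed

lemma sum_wS_front:
  "(\<Sum>j\<in>front J E p R (Suc t). wS E w j) = (\<Sum>u\<in>J - completed J E p R t. w u)"
  unfolding uncompleted_eq_UN_front wS_def by (rule sum_UN_succs_front[OF order_refl, symmetric])

lemma uncompleted_front_nonempty:
  "\<not> J \<subseteq> completed J E p R t \<Longrightarrow> front J E p R (Suc t) \<noteq> {}"
  using uncompleted_eq_UN_front[of R t] by auto

text \<open>A job completed in slot \<open>c\<close> is unfinished at the start of exactly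
  \<open>c\<close> slots, so the cost can be charged slot by slot.\<close>

lemma cost_eq_sum_uncompleted:
  assumes "J \<subseteq> completed J E p R T"
  shows "cost J E p w R = (\<Sum>t<T. \<Sum>u\<in>J - completed J E p R t. w u)"
proof -
  have "real (the_enat (completion J E p R j)) = (\<Sum>t<T. of_bool (j \<notin> completed J E p R t))"
    if "j \<in> J" for j
  proof -
    have "completion J E p R j < enat (Suc T)" using assms that by (auto simp: completion_less_Suc_iff)
    then obtain c where c: "completion J E p R j = enat c" "c \<le> T"
      by (cases "completion J E p R j") auto
    have iff: "j \<in> completed J E p R t \<longleftrightarrow> c \<le> t" for t
      using completion_less_Suc_iff[of J E p R j t] by (auto simp: c)
    have "(\<Sum>t<T. of_bool (j \<notin> completed J E p R t)) = real (card ({..<T} \<inter> {t. t < c}))"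
      by (simp add: iff not_le sum_of_bool_eq)
    also have "{..<T} \<inter> {t. t < c} = {..<c}" using c(2) by auto
    finally show ?thesis by (simp add: c)
  qed
  then have "cost J E p w R = (\<Sum>j\<in>J. \<Sum>t<T. w j * of_bool (j \<notin> completed J E p R t))"
    unfolding cost_def by (intro sum.cong refl) (simp only: sum_distrib_left)
  also have "\<dots> = (\<Sum>t<T. \<Sum>j\<in>J. w j * of_bool (j \<notin> completed J E p R t))" by (rule sum.swap)
  also have "\<dots> = (\<Sum>t<T. \<Sum>u\<in>J - completed J E p R t. w u)"
    using finite_J by (intro sum.cong refl sum.mono_neutral_cong_right) auto
  finally show ?thesis .
qed

text \<open>The predecessors of \<open>u\<close> form a chain, and comparable jobs never complete in
  the same slot, so each slot adds at most one.\<close>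

lemma card_completed_predecessors_le:
  "card {v \<in> completed J E p R t. (v, u) \<in> E\<^sup>*} \<le> t"
proof (induction t)
  case (Suc t)
  let ?P = "\<lambda>t. {v \<in> completed J E p R t. (v, u) \<in> E\<^sup>*}"
  have fin: "finite (?P s)" for s
    by (rule finite_subset[OF _ finite_J]) (use completed_sub_J[of R s] in blast)
  have "\<forall>v\<in>?P (Suc t) - ?P t. \<forall>v'\<in>?P (Suc t) - ?P t. v = v'"
  proof (intro ballI)
    fix v v' assume that: "v \<in> ?P (Suc t) - ?P t" "v' \<in> ?P (Suc t) - ?P t"
    show "v = v'"
    proof (rule ccontr)
      assume "v \<noteq> v'"
      then have "(v, v') \<in> E\<^sup>+ \<or> (v', v) \<in> E\<^sup>+"
        using predecessors_comparable[of v u v'] that unfolding rtrancl_eq_or_trancl[of v v']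
          rtrancl_eq_or_trancl[of v' v] by blast
      then show False
        using completed_trancl[of v v' R t] completed_trancl[of v' v R t] that by blast
    qed
  qed
  then have "card (?P (Suc t) - ?P t) \<le> 1"
    unfolding One_nat_def by (subst card_le_Suc0_iff_eq) (rule finite_Diff, rule fin)
  moreover have "card (?P (Suc t)) \<le> card (?P t \<union> (?P (Suc t) - ?P t))"
    using fin by (intro card_mono) blast+
  then have "card (?P (Suc t)) \<le> card (?P t) + card (?P (Suc t) - ?P t)"
    using card_Un_le order_trans by blast
  ultimately show ?case using Suc by linarith
qed simp

end

section \<open>The adaptive weight order algorithm\<close>

locale awo_run = out_forest J E p w
  for J :: "'a set" and E :: "('a \<times> 'a) set" and p w :: "'a \<Rightarrow> real" +
  fixes ord :: "nat \<Rightarrow> 'a rel" and \<epsilon> :: real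
  assumes orders: "\<forall>t\<ge>1. linear_order_on (front J E p (awo J E p ord) t) (ord t)"
    and eps_pos: "0 < \<epsilon>"
begin

abbreviation run :: "nat \<Rightarrow> 'a \<Rightarrow> real" where
  "run \<equiv> awo J E p ord"

abbreviation cmpl :: "nat \<Rightarrow> 'a set" where
  "cmpl t \<equiv> completed J E p run t"

abbreviation fr :: "nat \<Rightarrow> 'a set" where
  "fr t \<equiv> front J E p run (Suc t)"

definition work :: "'a \<Rightarrow> nat \<Rightarrow> real" where
  "work j t = (\<Sum>s=1..t. run s j)"

definition open_weight :: "nat \<Rightarrow> real" where
  "open_weight t = (\<Sum>u\<in>J - cmpl t. w u)"

definition K :: real where
  "K = max (1 + \<epsilon>) (real (order_error J E p w run ord \<epsilon>))"

definition M :: real where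
  "M = harm (width J E) * K"

lemma order_front: "linear_order_on (fr t) (ord (Suc t))"
  using orders by simp

lemma fr_sub_J: "fr t \<subseteq> J"
  by (auto simp: front_def)

lemma work_Suc: "work j (Suc t) = work j t + run (Suc t) j"
  by (simp add: work_def)

lemma run_Suc: "run (Suc t) j = awo_rate (fr t) (ord (Suc t)) j"
  by (rule awo_eq) simp

lemma run_nonneg: "1 \<le> t \<Longrightarrow> 0 \<le> run t j"
  using harm_nonneg
  by (cases t) (auto simp: run_Suc awo_rate_def simp del: inverse_mult_distrib intro!: mult_nonneg_nonneg)

lemma run_outside_front: "j \<notin> fr t \<Longrightarrow> run (Suc t) j = 0"
  by (simp add: run_Suc awo_rate_def)

lemma work_mono: "s \<le> t \<Longrightarrow> work j s \<le> work j t"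
  by (rule lift_Suc_mono_le[of "work j"]) (simp add: work_Suc run_nonneg)

section \<open>Termination and feasibility of the run\<close>

lemma sum_run: "(\<Sum>j\<in>J. run (Suc t) j) = (if fr t = {} then 0 else 1)"
proof -
  have "(\<Sum>j\<in>J. run (Suc t) j) = (\<Sum>j\<in>fr t. run (Suc t) j)"
    using finite_J fr_sub_J by (intro sum.mono_neutral_right) (auto simp: run_outside_front)
  then show ?thesis
    using sum_awo_rate[OF finite_front _ order_front[of t]] by (simp add: run_Suc)
qed

text \<open>Only the slot in which a job completes can overshoot \<open>p j\<close>, and by no more
  than its rate, which is at most 1.\<close>

lemma work_le:
  assumes "j \<in> J"
  shows "work j t \<le> p j + 1"
proof (induction t)
  case 0
  then show ?case using p_nonneg[OF assms] by (simp add: work_def)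
next
  case (Suc t)
  show ?case
  proof (cases "j \<in> fr t")
    case False
    then show ?thesis using Suc by (simp add: work_Suc run_outside_front)
  next
    case True
    have "run (Suc t) j \<le> (\<Sum>j\<in>J. run (Suc t) j)"
      using assms finite_J run_nonneg by (intro member_le_sum) auto
    then have "run (Suc t) j \<le> 1" by (simp add: sum_run split: if_splits)
    moreover have "work j t \<le> p j"
    proof (rule ccontr)
      assume *: "\<not> work j t \<le> p j"
      \<comment> \<open>Completion also requires completed predecessors. Nonzero work places
        \<open>j\<close> in an earlier front, which provides them.\<close>
      then have "work j t \<noteq> 0" using p_nonneg[OF assms] by auto
      then obtain s where s: "s \<in> {1..t}" "run s j \<noteq> 0"
        unfolding work_def by (meson sum.neutral)
      then obtain s' t' where st: "s = Suc s'" "t = Suc t'" "s' \<le> t'" by (cases s; cases t) auto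
      then have "j \<in> fr s'" using s run_outside_front by blast
      then have "(i, j) \<in> E \<longrightarrow> i \<in> cmpl t'" for i
        using completed_mono[OF st(3), of J E p run] by (auto simp: front_Suc)
      then have "j \<in> cmpl t" using * assms by (simp add: st work_def)
      then show False using True by (simp add: front_Suc)
    qed
    ultimately show ?thesis by (simp add: work_Suc)
  qed
qed

text \<open>Otherwise every slot is fully used and the total work after \<open>t\<close> slots is
  \<open>t\<close>, against the uniform bound from \<open>work_le\<close>.\<close>

lemma eventually_completed: "\<exists>T. J \<subseteq> cmpl T"
proof (rule ccontr)
  assume "\<nexists>T. J \<subseteq> cmpl T"
  then have ne: "fr t \<noteq> {}" for t using uncompleted_front_nonempty by blast
  have total: "(\<Sum>j\<in>J. work j t) = real t" for t
  proof (induction t)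
    case (Suc t)
    then show ?case using ne[of t] sum_run[of t] by (simp add: work_Suc sum.distrib)
  qed (simp add: work_def)
  obtain t where "(\<Sum>j\<in>J. p j + 1) < real t" using reals_Archimedean2 by blast
  moreover have "(\<Sum>j\<in>J. work j t) \<le> (\<Sum>j\<in>J. p j + 1)" by (intro sum_mono work_le)
  ultimately show False using total[of t] by linarith
qed

lemma feasible_run: "feasible J E p run"
  unfolding feasible_def
proof (intro conjI allI ballI impI)
  fix t :: nat assume t: "1 \<le> t"
  then obtain t' where t': "t = Suc t'" by (cases t) auto
  show "0 \<le> run t j" for j using t by (rule run_nonneg)
  show "(\<Sum>j\<in>J. run t j) \<le> 1" by (simp add: t' sum_run)
  show "completion J E p run i < enat t" if "0 < run t j" "(i, j) \<in> E" for i j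
  proof -
    have "j \<in> fr t'" using that(1) run_outside_front[of j t'] by (auto simp: t')
    then show ?thesis using that(2) by (auto simp: front_def t')
  qed
next
  fix j assume "j \<in> J"
  moreover obtain T where "J \<subseteq> cmpl T" using eventually_completed by blast
  ultimately have "completion J E p run j < enat (Suc T)" by (auto simp: completion_less_Suc_iff)
  also have "\<dots> < \<infinity>" by simp
  finally show "completion J E p run j < \<infinity>" .
qed

section \<open>Lower bound on the rates\<close>

lemma order_error_ge:
  assumes "j \<in> fr t"
  shows "card {i \<in> fr t. wS E w j / (1 + \<epsilon>) \<ge> wS E w i \<and> (i, j) \<in> ord (Suc t)}
    \<le> order_error J E p w run ord \<epsilon>"
proof -
  let ?S = "{card {i \<in> front J E p run t. wS E w j / (1 + \<epsilon>) \<ge> wS E w i \<and> (i, j) \<in> ord t} | t j.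
            1 \<le> t \<and> j \<in> front J E p run t}"
  \<comment> \<open>There are infinitely many slots, but this bound leaves finitely many values
    under the maximum.\<close>
  have "card {i \<in> front J E p run t. P i} \<le> card J" for t P
    using finite_J by (intro card_mono) (auto simp: front_def)
  then have "?S \<subseteq> {..card J}" by auto
  then have "finite ?S" using finite_subset by blast
  then show ?thesis unfolding order_error_def using assms by (intro Max_ge) (auto intro!: exI[of _ "Suc t"])
qed

lemma K_ge_1: "1 \<le> K"
  using eps_pos by (simp add: K_def)

text \<open>The width is at least the size of any front; the constants are the harmonic numbers of 1
  and 2.\<close>

lemma M_ge_1: "fr t \<noteq> {} \<Longrightarrow> 1 \<le> M"
  and M_ge_3_2: "2 \<le> card (fr t) \<Longrightarrow> 3 / 2 \<le> M"
proof -
  have mono: "harm m \<le> M" if "m \<le> width J E" for m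
  proof -
    have "harm m * 1 \<le> harm (width J E) * K"
      using that K_ge_1 harm_nonneg by (intro mult_mono harm_mono) auto
    then show ?thesis by (simp add: M_def)
  qed
  show "1 \<le> M" if "fr t \<noteq> {}"
  proof -
    have "0 < card (fr t)" using that by (simp add: card_gt_0_iff finite_front)
    then have "1 \<le> width J E" using card_front_le_width[of run t] by linarith
    from mono[OF this] show ?thesis by (simp add: harm_def)
  qed
  show "3 / 2 \<le> M" if "2 \<le> card (fr t)"
  proof -
    have "2 \<le> width J E" using that card_front_le_width[of run t] by linarith
    from mono[OF this] show ?thesis by (simp add: harm_def numeral_2_eq_2)
  qed
qed

lemma sum_wS_fr: "(\<Sum>j\<in>fr t. wS E w j) = open_weight t"
  unfolding open_weight_def by (rule sum_wS_front)

lemma open_weight_nonneg: "0 \<le> open_weight t"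
  unfolding open_weight_def using w_nonneg by (intro sum_nonneg) auto

text \<open>Each job in \<open>P1\<close> weighs more than
  \<open>wS E w j / (1 + \<epsilon>)\<close>, so \<open>P1\<close> is paid for by
  \<open>1 + \<epsilon>\<close> times the weight of the front; \<open>P2\<close> is one of the sets
  counted by \<open>order_error\<close>.\<close>

lemma position_weight_le:
  assumes "j \<in> fr t"
  shows "real (position (fr t) (ord (Suc t)) j) * wS E w j \<le> K * (open_weight t + wS E w j)"
proof -
  define P1 where "P1 = {i \<in> fr t. \<not> wS E w j / (1 + \<epsilon>) \<ge> wS E w i \<and> (i, j) \<in> ord (Suc t)}"
  define P2 where "P2 = {i \<in> fr t. wS E w j / (1 + \<epsilon>) \<ge> wS E w i \<and> (i, j) \<in> ord (Suc t)}"
  have nonneg: "0 \<le> wS E w i" if "i \<in> fr t" for i using that fr_sub_J wS_nonneg by blast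
  have "position (fr t) (ord (Suc t)) j \<le> card P1 + card P2"
    unfolding position_def
    by (rule order_trans[OF card_mono card_Un_le]) (auto simp: P1_def P2_def finite_front)
  then have "real (position (fr t) (ord (Suc t)) j) * wS E w j \<le> real (card P1 + card P2) * wS E w j"
    using nonneg[OF assms] by (intro mult_right_mono) auto
  moreover have "real (card P1) * wS E w j \<le> K * open_weight t"
  proof -
    have "real (card P1) * wS E w j = (\<Sum>i\<in>P1. wS E w j)" by simp
    also have "\<dots> \<le> (\<Sum>i\<in>P1. (1 + \<epsilon>) * wS E w i)"
      using eps_pos by (intro sum_mono) (auto simp: P1_def not_le field_simps)
    also have "\<dots> \<le> (\<Sum>i\<in>fr t. (1 + \<epsilon>) * wS E w i)"
      using eps_pos nonneg by (intro sum_mono2) (auto simp: P1_def finite_front)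
    also have "\<dots> = (1 + \<epsilon>) * open_weight t" by (simp add: sum_wS_fr flip: sum_distrib_left)
    also have "\<dots> \<le> K * open_weight t"
      using open_weight_nonneg by (intro mult_right_mono) (auto simp: K_def)
    finally show ?thesis .
  qed
  moreover have "real (card P2) * wS E w j \<le> K * wS E w j"
    using order_error_ge[OF assms] nonneg[OF assms]
    by (intro mult_right_mono) (auto simp: K_def P2_def le_max_iff_disj)
  ultimately show ?thesis by (simp add: algebra_simps)
qed

text \<open>This is \<open>position_weight_le\<close> multiplied by the rate, with the harmonic
  number of the front enlarged to that of the width.\<close>

lemma wS_le_rate:
  assumes "j \<in> fr t"
  shows "wS E w j \<le> M * run (Suc t) j * (open_weight t + wS E w j)"
proof -
  let ?H = "harm (card (fr t)) :: real" and ?i = "real (position (fr t) (ord (Suc t)) j)"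
  have pos: "0 < ?i" using bij_betwE[OF bij_betw_position[OF finite_front order_front[of t]]] assms
    by fastforce
  have H: "0 < ?H" using assms by (intro harm_pos) (auto simp: card_gt_0_iff finite_front)
  have nonneg: "0 \<le> wS E w j" using assms fr_sub_J wS_nonneg by blast
  have r: "run (Suc t) j = inverse (?H * ?i)" using assms by (simp add: run_Suc awo_rate_def)
  have "wS E w j = run (Suc t) j * ?H * (?i * wS E w j)" using less_imp_neq[OF pos] less_imp_neq[OF H] unfolding r by (simp add: field_simps)
  also have "\<dots> \<le> run (Suc t) j * ?H * (K * (open_weight t + wS E w j))"
    using position_weight_le[OF assms] run_nonneg
    by (intro mult_left_mono mult_nonneg_nonneg harm_nonneg) auto
  also have "\<dots> = ?H * (K * run (Suc t) j * (open_weight t + wS E w j))" by (simp add: mult_ac)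
  also have "\<dots> \<le> harm (width J E) * (K * run (Suc t) j * (open_weight t + wS E w j))"
    using K_ge_1 run_nonneg open_weight_nonneg nonneg card_front_le_width
    by (intro mult_right_mono harm_mono mult_nonneg_nonneg add_nonneg_nonneg) auto
  finally show ?thesis by (simp add: M_def mult_ac)
qed

section \<open>Potentials\<close>

definition depth_potential :: "nat \<Rightarrow> real" where
  "depth_potential t = (\<Sum>u\<in>J. w u * real (card {v \<in> J - cmpl t. (v, u) \<in> E\<^sup>*}))"

text \<open>A front job that completes disappears from the path to each of its successors. Subtrees
  of front jobs are disjoint, so the left-hand side counts each such \<open>u\<close> once.\<close>

lemma depth_potential_drop:
  "(\<Sum>j\<in>fr t \<inter> cmpl (Suc t). wS E w j) \<le> depth_potential t - depth_potential (Suc t)"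
proof -
  let ?A = "fr t \<inter> cmpl (Suc t)"
  let ?d = "\<lambda>t u. card {v \<in> J - cmpl t. (v, u) \<in> E\<^sup>*}"
  have sub: "(\<Union>j\<in>?A. succs E j) \<subseteq> J" using fr_sub_J succs_sub_J by blast
  have dec: "real (?d (Suc t) u) + of_bool (u \<in> (\<Union>j\<in>?A. succs E j)) \<le> real (?d t u)" for u
  proof -
    have fin: "finite {v \<in> J - cmpl t. (v, u) \<in> E\<^sup>*}" using finite_J by auto
    have sub: "{v \<in> J - cmpl (Suc t). (v, u) \<in> E\<^sup>*} \<subseteq> {v \<in> J - cmpl t. (v, u) \<in> E\<^sup>*}"
      using completed_mono[of t "Suc t" J E p run] by auto
    show ?thesis
    proof (cases "u \<in> (\<Union>j\<in>?A. succs E j)")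
      case True
      then obtain j where "j \<in> fr t" "j \<in> cmpl (Suc t)" "(j, u) \<in> E\<^sup>*" by (auto simp: succs_def)
      then have "j \<in> {v \<in> J - cmpl t. (v, u) \<in> E\<^sup>*}" "j \<notin> {v \<in> J - cmpl (Suc t). (v, u) \<in> E\<^sup>*}"
        by (auto simp: front_Suc)
      then have "?d (Suc t) u < ?d t u" using sub fin by (intro psubset_card_mono) blast+
      then show ?thesis using True by simp
    next
      case False
      then show ?thesis using card_mono[OF fin sub] by simp
    qed
  qed
  have "(\<Sum>j\<in>?A. wS E w j) = (\<Sum>u\<in>(\<Union>j\<in>?A. succs E j). w u)"
    unfolding wS_def by (rule sum_UN_succs_front[symmetric]) auto
  also have "\<dots> = (\<Sum>u\<in>J. w u * of_bool (u \<in> (\<Union>j\<in>?A. succs E j)))"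
    using finite_J sub by (intro sum.mono_neutral_cong_left) auto
  also have "\<dots> \<le> (\<Sum>u\<in>J. w u * (real (?d t u) - real (?d (Suc t) u)))"
    using w_nonneg dec by (intro sum_mono mult_left_mono) (auto simp: le_diff_eq add.commute)
  also have "\<dots> = depth_potential t - depth_potential (Suc t)"
    by (simp add: depth_potential_def sum_subtractf right_diff_distrib)
  finally show ?thesis .
qed

end

section \<open>Comparison with an arbitrary feasible schedule\<close>

locale awo_versus_schedule = awo_run +
  fixes R :: "nat \<Rightarrow> 'a \<Rightarrow> real"
  assumes R_feasible: "feasible J E p R"
begin

definition ctime :: "'a \<Rightarrow> nat" where
  "ctime u = the_enat (completion J E p R u)"

definition swork :: "'a \<Rightarrow> nat \<Rightarrow> real" where
  "swork j t = (\<Sum>s=1..t. R s j)"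

definition work_potential :: "nat \<Rightarrow> real" where
  "work_potential t = (\<Sum>u\<in>J. w u * (\<Sum>j\<in>J. max 0 (swork j (ctime u) - work j t)))"

lemma completed_iff_ctime: "u \<in> J \<Longrightarrow> u \<in> completed J E p R t \<longleftrightarrow> ctime u \<le> t"
proof -
  assume "u \<in> J"
  then have "completion J E p R u < \<infinity>" using R_feasible by (simp add: feasible_def)
  then obtain c where "completion J E p R u = enat c" by (cases "completion J E p R u") auto
  then show ?thesis using completion_less_Suc_iff[of J E p R u t] by (auto simp: ctime_def)
qed

lemma R_nonneg: "1 \<le> s \<Longrightarrow> j \<in> J \<Longrightarrow> 0 \<le> R s j"
  using R_feasible by (simp add: feasible_def)

lemma swork_mono: "j \<in> J \<Longrightarrow> s \<le> t \<Longrightarrow> swork j s \<le> swork j t"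
  unfolding swork_def using R_nonneg by (intro sum_mono2) auto

lemma ctime_mono:
  assumes "(j, u) \<in> E\<^sup>*" and "u \<in> J"
  shows "ctime j \<le> ctime u"
  using completed_rtrancl[OF assms(1), of R "ctime u"] assms(2) rtrancl_in_J[OF assms(1)]
  by (simp add: completed_iff_ctime)

lemma swork_ctime_ge:
  assumes "(j, u) \<in> E\<^sup>*" and "u \<in> J"
  shows "p j \<le> swork j (ctime u)"
proof -
  have j: "j \<in> J" using assms rtrancl_in_J by auto
  then have "p j \<le> swork j (ctime j)"
    unfolding swork_def using R_nonneg completed_iff_ctime by (intro completed_le_work) auto
  also have "\<dots> \<le> swork j (ctime u)" using j ctime_mono[OF assms] by (rule swork_mono)
  finally show ?thesis .
qed

lemma cost_R: "cost J E p w R = (\<Sum>u\<in>J. w u * real (ctime u))"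
  by (simp add: cost_def ctime_def)

text \<open>By \<open>ctime u\<close> the schedule \<open>R\<close> has completed the whole path to
  \<open>u\<close>, at most one job per slot.\<close>

lemma depth_potential_0: "depth_potential 0 \<le> cost J E p w R"
  unfolding depth_potential_def cost_R
proof (intro sum_mono mult_left_mono)
  fix u assume u: "u \<in> J"
  have "{v \<in> J - cmpl 0. (v, u) \<in> E\<^sup>*} \<subseteq> {v \<in> completed J E p R (ctime u). (v, u) \<in> E\<^sup>*}"
    using completed_iff_ctime ctime_mono[OF _ u] by blast
  then have "card {v \<in> J - cmpl 0. (v, u) \<in> E\<^sup>*} \<le> card {v \<in> completed J E p R (ctime u). (v, u) \<in> E\<^sup>*}"
    using finite_subset[OF completed_sub_J finite_J, of R "ctime u"] by (intro card_mono) auto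
  also have "\<dots> \<le> ctime u" by (rule card_completed_predecessors_le)
  finally show "real (card {v \<in> J - cmpl 0. (v, u) \<in> E\<^sup>*}) \<le> real (ctime u)" by simp
qed (rule w_nonneg)

text \<open>The inner sum is all the work of \<open>R\<close> up to \<open>ctime u\<close>, at most
  one unit per slot.\<close>

lemma work_potential_0: "work_potential 0 \<le> cost J E p w R"
  unfolding work_potential_def cost_R
proof (intro sum_mono mult_left_mono)
  fix u
  have "(\<Sum>j\<in>J. max 0 (swork j (ctime u) - work j 0)) = (\<Sum>j\<in>J. swork j (ctime u))"
    unfolding work_def swork_def using R_nonneg by (intro sum.cong) (auto intro!: max_absorb2 sum_nonneg)
  also have "\<dots> = (\<Sum>s=1..ctime u. \<Sum>j\<in>J. R s j)" unfolding swork_def by (rule sum.swap)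
  also have "\<dots> \<le> (\<Sum>s=1..ctime u. 1)"
    using R_feasible by (intro sum_mono) (auto simp: feasible_def)
  finally show "(\<Sum>j\<in>J. max 0 (swork j (ctime u) - work j 0)) \<le> real (ctime u)" by simp
qed (rule w_nonneg)

text \<open>Processing \<open>j\<close> lowers the potential of every \<open>u\<close> that
  \<open>R\<close> completes only after catching up with the algorithm on \<open>j\<close>. If
  \<open>\<tau> j \<le> \<tau> l\<close>, this holds for all successors of \<open>l\<close>. The
  mere existence of \<tau> suffices, as \<open>sum_square_le_ordered_pairs\<close> accepts any
  \<tau>.\<close>

lemma work_potential_drop:
  obtains \<tau> :: "'a \<Rightarrow> nat" where
  "(\<Sum>j\<in>fr t - cmpl (Suc t). \<Sum>l\<in>fr t - cmpl (Suc t). of_bool (\<tau> j \<le> \<tau> l) * (run (Suc t) j * wS E w l))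
     \<le> work_potential t - work_potential (Suc t)"
proof -
  define B where "B = fr t - cmpl (Suc t)"
  \<comment> \<open>The time at which \<open>R\<close> catches up on \<open>j\<close>; for
    \<open>j\<close> in \<open>B\<close> it exists because \<open>R\<close> eventually performs
    \<open>p j\<close>, which exceeds \<open>work j (Suc t)\<close>.\<close>
  define \<tau> where "\<tau> j = (LEAST s. work j (Suc t) \<le> swork j s)" for j
  have B: "B \<subseteq> fr t" "B \<subseteq> J" "finite B" using fr_sub_J finite_front[of run "Suc t"] by (auto simp: B_def)
  have unfinished: "work l (Suc t) < p l" if "l \<in> B" for l
    using that by (auto simp: B_def front_Suc work_def not_le)
  have \<tau>: "work j (Suc t) \<le> swork j (\<tau> j)" "\<tau> j \<le> ctime u" if "j \<in> B" "u \<in> succs E j" for j u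
  proof -
    have "u \<in> J" using that succs_sub_J B by auto
    then have "work j (Suc t) \<le> swork j (ctime u)"
      using unfinished[OF that(1)] swork_ctime_ge[of j u] that by (auto simp: succs_def)
    then show "work j (Suc t) \<le> swork j (\<tau> j)" "\<tau> j \<le> ctime u"
      unfolding \<tau>_def by (rule LeastI, rule Least_le)
  qed
  have self: "j \<in> succs E j" for j by (simp add: succs_def)
  let ?g = "\<lambda>u j. max 0 (swork j (ctime u) - work j t) - max 0 (swork j (ctime u) - work j (Suc t))"
  have g: "0 \<le> ?g u j" for u j using work_mono[of t "Suc t" j] by auto
  have "(\<Sum>j\<in>B. \<Sum>l\<in>B. of_bool (\<tau> j \<le> \<tau> l) * (run (Suc t) j * wS E w l))
      = (\<Sum>l\<in>B. \<Sum>j\<in>B. of_bool (\<tau> j \<le> \<tau> l) * (run (Suc t) j * wS E w l))" by (rule sum.swap)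
  also have "\<dots> = (\<Sum>l\<in>B. \<Sum>j\<in>B. \<Sum>u\<in>succs E l. w u * (of_bool (\<tau> j \<le> \<tau> l) * run (Suc t) j))"
    by (simp add: wS_def sum_distrib_left sum_distrib_right mult_ac)
  also have "\<dots> = (\<Sum>l\<in>B. \<Sum>u\<in>succs E l. \<Sum>j\<in>B. w u * (of_bool (\<tau> j \<le> \<tau> l) * run (Suc t) j))"
    by (intro sum.cong refl sum.swap)
  also have "\<dots> \<le> (\<Sum>l\<in>B. \<Sum>u\<in>succs E l. \<Sum>j\<in>B. w u * ?g u j)"
  proof (intro sum_mono mult_left_mono)
    fix l u j assume *: "l \<in> B" "u \<in> succs E l" "j \<in> B"
    show "0 \<le> w u" using * w_nonneg succs_sub_J B by blast
    show "of_bool (\<tau> j \<le> \<tau> l) * run (Suc t) j \<le> ?g u j"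
    proof (cases "\<tau> j \<le> \<tau> l")
      case True
      \<comment> \<open>Since \<open>\<tau> j \<le> \<tau> l \<le> ctime u\<close>, neither maximum
        in \<open>?g u j\<close> is truncated at 0, so the drop equals the rate.\<close>
      have "work j (Suc t) \<le> swork j (\<tau> j)" using *(3) self by (rule \<tau>(1))
      also have "\<dots> \<le> swork j (ctime u)"
        using True \<tau>(2)[OF *(1,2)] * B by (intro swork_mono) auto
      finally show ?thesis using True run_nonneg[of "Suc t" j] by (simp add: work_Suc)
    qed (use g in simp)
  qed
  also have "\<dots> = (\<Sum>u\<in>(\<Union>l\<in>B. succs E l). \<Sum>j\<in>B. w u * ?g u j)"
    using B(1) by (rule sum_UN_succs_front[symmetric])
  also have "\<dots> \<le> (\<Sum>u\<in>J. \<Sum>j\<in>B. w u * ?g u j)"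
  proof (rule sum_mono2[OF finite_J])
    show "(\<Union>l\<in>B. succs E l) \<subseteq> J" using B(2) succs_sub_J by blast
    show "0 \<le> (\<Sum>j\<in>B. w u * ?g u j)" if "u \<in> J - (\<Union>l\<in>B. succs E l)" for u
      using w_nonneg that g by (intro sum_nonneg mult_nonneg_nonneg) auto
  qed
  also have "\<dots> \<le> (\<Sum>u\<in>J. \<Sum>j\<in>J. w u * ?g u j)"
    using finite_J B(2) w_nonneg g by (intro sum_mono sum_mono2 mult_nonneg_nonneg) blast+
  also have "\<dots> = work_potential t - work_potential (Suc t)"
    by (simp add: work_potential_def sum_subtractf right_diff_distrib sum_distrib_left)
  finally show thesis unfolding B_def by (rule that)
qed

lemma work_potential_antimono: "work_potential (Suc t) \<le> work_potential t"
  unfolding work_potential_def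
  by (intro sum_mono mult_left_mono max.mono diff_left_mono work_mono w_nonneg) auto

lemma open_weight_le_potential_drop:
  "open_weight t \<le> 5 / 2 * (M * (work_potential t - work_potential (Suc t)))
     + 3 / 2 * (M * (depth_potential t - depth_potential (Suc t)))"
proof (cases "fr t = {}")
  case True
  then have "open_weight t = 0" using sum_wS_fr[of t] by simp
  moreover have "0 \<le> M" using K_ge_1 harm_nonneg by (auto simp: M_def intro!: mult_nonneg_nonneg)
  moreover have "0 \<le> depth_potential t - depth_potential (Suc t)"
    using depth_potential_drop[of t] True by simp
  ultimately show ?thesis using work_potential_antimono[of t] by simp
next
  case False
  define B where "B = fr t - cmpl (Suc t)"
  define b where "b = (\<Sum>j\<in>B. wS E w j)"
  \<comment> \<open>The inserted 0 is the value for empty \<open>B\<close>.\<close>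
  define m where "m = Max (insert 0 (wS E w ` B))"
  obtain \<tau> :: "'a \<Rightarrow> nat" where \<tau>:
    "(\<Sum>j\<in>B. \<Sum>l\<in>B. of_bool (\<tau> j \<le> \<tau> l) * (run (Suc t) j * wS E w l))
     \<le> work_potential t - work_potential (Suc t)"
    using work_potential_drop unfolding B_def by blast
  have B: "B \<subseteq> fr t" "finite B" using finite_front[of run "Suc t"] by (auto simp: B_def)
  have nonneg: "0 \<le> wS E w j" if "j \<in> fr t" for j using that fr_sub_J wS_nonneg by blast
  have m_ge: "wS E w j \<le> m" if "j \<in> B" for j using that B by (auto simp: m_def intro!: Max_ge)
  have m0: "0 \<le> m" using B by (auto simp: m_def intro!: Max_ge)
  have "m \<in> insert 0 (wS E w ` B)" unfolding m_def using B by (intro Max_in) auto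
  then have m: "m = 0 \<or> (\<exists>j\<in>B. m = wS E w j)" by auto
  have mb: "m \<le> b"
    using m B nonneg by (auto simp: b_def intro!: sum_nonneg member_le_sum)
  \<comment> \<open>The extra diagonal of \<open>sum_square_le_ordered_pairs\<close> thus supplies
    the \<open>m\<^sup>2\<close> of \<open>slot_inequality\<close>.\<close>
  have m2: "m\<^sup>2 \<le> (\<Sum>j\<in>B. (wS E w j)\<^sup>2)"
    using m B nonneg by (auto intro!: sum_nonneg member_le_sum[where f = "\<lambda>j. (wS E w j)\<^sup>2"])
  have split: "open_weight t = (\<Sum>j\<in>fr t \<inter> cmpl (Suc t). wS E w j) + b"
    unfolding b_def B_def sum_wS_fr[symmetric] by (rule sum.Int_Diff) (rule finite_front)
  have bW: "b \<le> open_weight t" unfolding split using nonneg by (auto intro: sum_nonneg)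
  have M1: "1 \<le> M" using False by (rule M_ge_1)
  show ?thesis
  proof (rule slot_inequality[OF m0 mb bW M1])
    show "0 \<le> M * (work_potential t - work_potential (Suc t))"
      using M1 work_potential_antimono[of t] by simp
    show "open_weight t - b \<le> depth_potential t - depth_potential (Suc t)"
      using depth_potential_drop[of t] split by simp
    show "3 / 2 \<le> M \<or> b = 0 \<or> b = open_weight t"
    \<comment> \<open>For a single front job, \<open>M\<close> may be close to \<open>1\<close>, but then \<open>b\<close> is extremal.\<close>
    proof (cases "2 \<le> card (fr t)")
      case True
      then show ?thesis using M_ge_3_2 by blast
    next
      case False
      then have "card (fr t) = 1"
        using \<open>fr t \<noteq> {}\<close> card_0_eq[OF finite_front[of run "Suc t"]] by linarith
      then obtain x where "fr t = {x}" by (auto simp: card_1_singleton_iff)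
      then have "B = {} \<or> B = fr t" using B(1) by (simp add: subset_singleton_iff)
      then show ?thesis unfolding b_def sum_wS_fr[symmetric] by auto
    qed
    \<comment> \<open>In each pair only the weight of \<open>j\<close> is traded for its rate;
      bounding \<open>wS E w j\<close> by \<open>m\<close> there gives all pairs the common factor
      \<open>open_weight t + m\<close>.\<close>
    have "b\<^sup>2 + m\<^sup>2 \<le> 2 * (\<Sum>j\<in>B. \<Sum>l\<in>B. of_bool (\<tau> j \<le> \<tau> l) * (wS E w j * wS E w l))"
      unfolding b_def using m2 B(1) nonneg
      by (intro order_trans[OF add_left_mono sum_square_le_ordered_pairs[OF B(2), of "wS E w" \<tau>]]) blast+
    also have "(\<Sum>j\<in>B. \<Sum>l\<in>B. of_bool (\<tau> j \<le> \<tau> l) * (wS E w j * wS E w l))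
        \<le> (\<Sum>j\<in>B. \<Sum>l\<in>B. of_bool (\<tau> j \<le> \<tau> l) * ((M * run (Suc t) j * (open_weight t + m)) * wS E w l))"
    proof (intro sum_mono mult_left_mono mult_right_mono)
      fix j l assume *: "j \<in> B" "l \<in> B"
      have "wS E w j \<le> M * run (Suc t) j * (open_weight t + wS E w j)"
        using * B by (intro wS_le_rate) auto
      also have "\<dots> \<le> M * run (Suc t) j * (open_weight t + m)"
        using M1 run_nonneg m_ge * by (intro mult_left_mono) auto
      finally show "wS E w j \<le> M * run (Suc t) j * (open_weight t + m)" .
    qed (use nonneg B in auto)
    also have "\<dots> = M * (open_weight t + m)
        * (\<Sum>j\<in>B. \<Sum>l\<in>B. of_bool (\<tau> j \<le> \<tau> l) * (run (Suc t) j * wS E w l))"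
      by (simp add: sum_distrib_left mult_ac)
    also have "\<dots> \<le> M * (open_weight t + m) * (work_potential t - work_potential (Suc t))"
      using \<tau> M1 m0 open_weight_nonneg by (intro mult_left_mono) auto
    finally show "b\<^sup>2 + m\<^sup>2 \<le> 2 * (M * (work_potential t - work_potential (Suc t)) * (open_weight t + m))"
      by (simp add: mult_ac)
  qed
qed

lemma cost_run_le: "cost J E p w run \<le> 4 * M * cost J E p w R"
proof -
  obtain T where T: "J \<subseteq> cmpl T" using eventually_completed by blast
  \<comment> \<open>The slot bounds telescope in \<open>G\<close>. Both potentials start at no more
    than the cost of \<open>R\<close>, and the coefficients add up to 4.\<close>
  define G where "G t = 5 / 2 * (M * work_potential t) + 3 / 2 * (M * depth_potential t)" for t
  have M0: "0 \<le> M" using K_ge_1 harm_nonneg by (auto simp: M_def intro!: mult_nonneg_nonneg)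
  have "cost J E p w run = (\<Sum>t<T. open_weight t)"
    unfolding open_weight_def by (rule cost_eq_sum_uncompleted[OF T])
  also have "\<dots> \<le> (\<Sum>t<T. G t - G (Suc t))"
    using open_weight_le_potential_drop by (intro sum_mono) (simp add: G_def algebra_simps)
  also have "\<dots> = G 0 - G T" by (rule sum_lessThan_telescope')
  also have "\<dots> \<le> G 0"
  proof -
    have "0 \<le> work_potential T" "0 \<le> depth_potential T"
      unfolding work_potential_def depth_potential_def using w_nonneg
      by (auto intro!: sum_nonneg mult_nonneg_nonneg)
    then have "0 \<le> G T" using M0 by (simp add: G_def)
    then show ?thesis by simp
  qed
  also have "\<dots> \<le> 5 / 2 * (M * cost J E p w R) + 3 / 2 * (M * cost J E p w R)"
    unfolding G_def using M0 work_potential_0 depth_potential_0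
    by (intro add_mono mult_left_mono) auto
  finally show ?thesis by (simp add: algebra_simps)
qed

end

section \<open>Passage to the optimum\<close>

theorem theorem9:
  fixes J :: "'a set" and E :: "('a \<times> 'a) set" and p w :: "'a \<Rightarrow> real"
    and ord :: "nat \<Rightarrow> 'a rel" and \<epsilon> :: real
  assumes "out_forest_instance J E p w"
    and "\<forall>t\<ge>1. linear_order_on (front J E p (awo J E p ord) t) (ord t)"
    and "\<epsilon> > 0"
  shows "feasible J E p (awo J E p ord) \<and>
    cost J E p w (awo J E p ord) \<le>
      4 * harm (width J E) * max (1 + \<epsilon>) (real (order_error J E p w (awo J E p ord) ord \<epsilon>))
        * opt J E p w"
proof -
  interpret awo_run J E p w ord \<epsilon>
    using assms by unfold_locales
  have bound: "cost J E p w run \<le> 4 * M * cost J E p w R" if "feasible J E p R" for R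
  proof -
    interpret awo_versus_schedule J E p w ord \<epsilon> R using that by unfold_locales
    show ?thesis by (rule cost_run_le)
  qed
  have "cost J E p w run \<le> 4 * M * opt J E p w"
  \<comment> \<open>Without jobs the width and hence \<open>M\<close> are 0, which rules out the
    division by \<open>4 * M\<close> made in the other case.\<close>
  proof (cases "J = {}")
    case True
    then have "opt J E p w = (INF R\<in>{R. feasible J E p R}. 0)" by (simp add: opt_def cost_def)
    also have "\<dots> = 0" using feasible_run by (intro cINF_const) blast
    finally show ?thesis using True by (simp add: cost_def)
  next
    case False
    then have "fr 0 \<noteq> {}" by (intro uncompleted_front_nonempty) simp
    then have M: "0 < 4 * M" using M_ge_1 by fastforce
    have "cost J E p w run / (4 * M) \<le> opt J E p w"
      unfolding opt_def
    proof (rule cINF_greatest)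
      show "{R. feasible J E p R} \<noteq> {}" using feasible_run by blast
      show "cost J E p w run / (4 * M) \<le> cost J E p w R" if "R \<in> {R. feasible J E p R}" for R
        using bound[of R] that M by (simp add: divide_le_eq mult_ac)
    qed
    then show ?thesis using M by (simp add: divide_le_eq mult_ac)
  qed
  then show ?thesis using feasible_run by (simp add: M_def K_def mult_ac)
qed

end
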